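(* There exist an infinite set $A=\{a_1<a_2<\cdots\}$ of positive integers and a set $B$ of positive integers such that $A,B$ are exact additive complements, $$\frac{a_{n+1}}{n\,a_n}\to\infty\quad\text{as } n\to\infty,$$ and $$\liminf_{x\to\infty}\ \frac{A(x)B(x)-x-\dfrac{a^*(x)}{A(x)}}{\dfrac{a^*(x)}{A(x)^2}}\ \le\ 1,$$ where $x$ runs over the positive integers.
   Context: For a set $S$ of positive integers and real $x$, $S(x)=|S\cap[1,x]|$ denotes the counting function of $S$; in particular $A(x)=|A\cap[1,x]|$ and $B(x)=|B\cap[1,x]|$. For $x\ge a_1$, $a^*(x)$ denotes the largest element of $A\cap[1,x]$. The sumset is $A+B=\{a+b: a\in A,\ b\in B\}$. Two sets $A,B$ of positive integers are called additive complements if $A+B$ contains all sufficiently large integers; they are called exact additive complements if, in addition, $A(x)B(x)/x\to 1$ as $x\to\infty$. *)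

theory Defs
  imports "HOL-Analysis.Analysis" "HOL-Library.Set_Algebras" "HOL-Library.Infinite_Set"
begin

definition counting :: "nat set \<Rightarrow> real \<Rightarrow> nat" where
  "counting S x = card {n \<in> S. 1 \<le> n \<and> real n \<le> x}"

text \<open>The value is meaningful only when \<open>A\<close> has a positive element that is at most \<open>x\<close>.\<close>
definition largest_upto :: "nat set \<Rightarrow> real \<Rightarrow> nat" where
  "largest_upto A x = Max {a \<in> A. 1 \<le> a \<and> real a \<le> x}"

text \<open>\<open>enumerate\<close> counts from 0, whereas \<open>A = {a\<^sub>1 < a\<^sub>2 < \<dots>}\<close> counts from 1; the value at
  \<open>n = 0\<close> is junk.\<close>
definition nth_element :: "nat set \<Rightarrow> nat \<Rightarrow> nat" where
  "nth_element A n = enumerate A (n - 1)"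

definition additive_complements :: "nat set \<Rightarrow> nat set \<Rightarrow> bool" where
  "additive_complements A B \<longleftrightarrow>
     A \<subseteq> {0<..} \<and> B \<subseteq> {0<..} \<and> (\<forall>\<^sub>F n in sequentially. n \<in> A + B)"

definition exact_additive_complements :: "nat set \<Rightarrow> nat set \<Rightarrow> bool" where
  "exact_additive_complements A B \<longleftrightarrow>
     additive_complements A B \<and>
     ((\<lambda>x::real. real (counting A x) * real (counting B x) / x) \<longlongrightarrow> 1) at_top"

end

theory Submission
  imports Defs "HOL-Number_Theory.Cong" "HOL-Real_Asymp.Real_Asymp"
begin

text \<open>
  If the first \<open>k\<close> elements of \<open>A\<close> represent all residues modulo \<open>q \<le> k\<close>, then the multiples of \<open>q\<close>
  serve as \<open>B\<close> on a long range, with density \<open>1/q\<close>. Letting successive ranges overlap in a length \<open>a\<^sub>k\<close>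
  near \<open>k a\<^sub>k\<close> costs only a factor \<open>1 + O(1/k)\<close>, so exactness needs \<open>q/k \<rightarrow> 1\<close>. If moreover
  \<open>q = k\<close>, then at \<open>x = a\<^bsub>k+1\<^esub>\<close>, where \<open>A(x)\<close> has just jumped to \<open>k + 1\<close> but \<open>B(x)\<close> is still about
  \<open>x/k\<close>, the excess \<open>A(x)B(x) - x\<close> is about \<open>x/k = x/(k+1) + x/(k(k+1))\<close>; so it suffices that
  \<open>q = k\<close> happens infinitely often.

  Such an \<open>A\<close> is built in stages. Given \<open>a\<^sub>1, \<dots>, a\<^sub>K\<close>, pick a prime \<open>L > a\<^sub>K\<close>, so that these elements are
  distinct modulo \<open>L\<close>. By the Chinese remainder theorem the elements \<open>a\<^sub>i\<close> with \<open>K < i \<le> L\<close> can be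
  chosen, arbitrarily large, to fill up the remaining residues modulo \<open>L\<close> and at the same time to
  satisfy \<open>a\<^sub>i \<equiv> i\<close> modulo every \<open>q \<le> L\<^sup>2\<close> coprime to \<open>L\<close>. The latter makes \<open>k - O(\<surd>k)\<close> consecutive
  elements a complete residue system for every \<open>k\<close>.
\<close>

section \<open>A rapidly growing sequence that covers residue classes economically\<close>

definition covers_residues :: "(nat \<Rightarrow> nat) \<Rightarrow> nat set \<Rightarrow> nat \<Rightarrow> bool" where
  "covers_residues a I q \<longleftrightarrow> (\<forall>r. \<exists>i\<in>I. [a i = r] (mod q))"

lemma covers_residues_consecutive:
  assumes "\<And>i. s \<le> i \<Longrightarrow> i < k \<Longrightarrow> [a i = i] (mod q)" and "0 < q" and "s + q \<le> k"
  shows "covers_residues a {..<k} q"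
  unfolding covers_residues_def
proof
  fix r
  \<comment> \<open>Modulo \<open>q\<close>, \<open>s * (q - 1)\<close> stands for minus
    \<open>s\<close>, so \<open>i\<close> is the index from \<open>s\<close> to
    \<open>s + q - 1\<close> congruent to \<open>r\<close>.\<close>
  define i where "i = s + (r + s * (q - 1)) mod q"
  have i: "s \<le> i" "i < k"
    using assms(2,3) mod_less_divisor[of q "r + s * (q - 1)"] unfolding i_def by linarith+
  have "s * q = s + s * (q - 1)"
    using assms(2) by (cases q) simp_all
  moreover have "[i = s + (r + s * (q - 1))] (mod q)"
    unfolding i_def by (simp add: cong_def mod_add_right_eq)
  ultimately have "[i = r + s * q] (mod q)"
    by (simp add: ac_simps)
  then have "[i = r] (mod q)"
    by (simp add: cong_def)
  then show "\<exists>i\<in>{..<k}. [a i = r] (mod q)"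
    using assms(1)[OF i] i(2) cong_trans by blast
qed

lemma chinese_remainder_above:
  fixes m n :: nat
  assumes "coprime m n" "0 < m" "0 < n"
  shows "\<exists>x\<ge>c. [x = u] (mod m) \<and> [x = v] (mod n)"
proof -
  obtain x where x: "[x = u] (mod m)" "[x = v] (mod n)"
    using binary_chinese_remainder_nat[OF assms(1)] by blast
  have "[x + m * (c * n) = u] (mod m)" "[x + n * (c * m) = v] (mod n)"
    using x by (simp_all add: cong_def)
  then have "[x + c * (m * n) = u] (mod m)" "[x + c * (m * n) = v] (mod n)"
    by (simp_all add: ac_simps)
  moreover have "c \<le> x + c * (m * n)"
    using assms(2,3) by (simp add: trans_le_add2)
  ultimately show ?thesis
    by blast
qed

section \<open>Rapid growth and the construction in stages\<close>

text \<open>The exponent 5 is what the excess estimate consumes. At \<open>x = a (Suc n)\<close> up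
  to \<open>(n + 1) * a n\<close> stray elements of the complement are multiplied by
  \<open>n + 2\<close> and divided by \<open>x / (n + 2) ^ 2\<close>; the result has to be
  O(1/n).\<close>

definition rapidly_growing :: "(nat \<Rightarrow> nat) \<Rightarrow> bool" where
  "rapidly_growing a \<longleftrightarrow> 0 < a 0 \<and> (\<forall>n. (n + 2) ^ 5 * a n \<le> a (Suc n))"

lemma rapidly_growing_pos:
  assumes "rapidly_growing a"
  shows "0 < a n"
proof (induction n)
  case 0
  then show ?case using assms by (simp add: rapidly_growing_def)
next
  case (Suc n)
  then have "0 < (n + 2) ^ 5 * a n" by simp
  also have "\<dots> \<le> a (Suc n)" using assms by (simp add: rapidly_growing_def)
  finally show ?case .
qed

lemma rapidly_growing_strict_mono:
  assumes "rapidly_growing a"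
  shows "strict_mono a"
proof (rule strict_mono_Suc_iff[THEN iffD2], rule allI)
  fix n :: nat
  have "1 < (n + 2) ^ 5"
    by (rule one_less_power) simp_all
  then have "a n < (n + 2) ^ 5 * a n"
    using rapidly_growing_pos[OF assms, of n] by simp
  also have "\<dots> \<le> a (Suc n)" using assms by (simp add: rapidly_growing_def)
  finally show "a n < a (Suc n)" .
qed

text \<open>The following stage starts at \<open>L\<close> and has its prime above
  \<open>L\<^sup>2\<close>. So for \<open>k \<le> L\<^sup>2\<close> the congruences of this stage
  reach all moduli up to \<open>k\<close>, and for larger \<open>k\<close> the first
  \<open>L\<close> elements can be discarded at a cost below the square root of \<open>k\<close>.
  Multiples of \<open>L\<close> are left out because the residues modulo \<open>L\<close> are
  reserved for completing the system.\<close>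

definition next_stage ::
  "(nat \<Rightarrow> nat) \<Rightarrow> nat \<Rightarrow> (nat \<Rightarrow> nat) \<Rightarrow> nat \<Rightarrow> bool" where
  "next_stage f K g L \<longleftrightarrow> K\<^sup>2 < L \<and> prime L \<and> (\<forall>i<K. g i = f i) \<and>
     covers_residues g {..<L} L \<and>
     (\<forall>i q. K \<le> i \<longrightarrow> i < L \<longrightarrow> 0 < q \<longrightarrow> q \<le> L\<^sup>2 \<longrightarrow> coprime q L \<longrightarrow> [g i = i] (mod q))"

text \<open>The product \<open>M\<close> of all moduli to be controlled is coprime to
  \<open>L\<close>, so one use of the Chinese remainder theorem per index meets every congruence,
  with a solution as large as growth demands.\<close>

lemma next_stage_exists:
  assumes f: "rapidly_growing f" and "0 < K"
  shows "\<exists>g L. rapidly_growing g \<and> next_stage f K g L"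
proof -
  obtain L where L: "prime L" "max (f K) (K\<^sup>2) < L"
    using bigger_prime by blast
  have mono: "strict_mono f"
    using f by (rule rapidly_growing_strict_mono)
  have "K \<le> K\<^sup>2"
    by (simp add: power2_eq_square)
  then have KL: "K < L"
    using L(2) by linarith
  have fL: "f i < L" if "i < K" for i
    using L(2) strict_monoD[OF mono that] by linarith
  have inj: "inj_on f {..<K}"
    using mono by (meson strict_mono_imp_inj_on subset_UNIV inj_on_subset)
  \<comment> \<open>The old elements are their own residues modulo \<open>L\<close>;
    \<open>h\<close> hands the residues they miss to the new indices, one each.\<close>
  have "card ({..<L} - f ` {..<K}) = L - K"
    using fL by (subst card_Diff_subset) (auto simp: card_image[OF inj])
  then obtain h where h: "bij_betw h {K..<L} ({..<L} - f ` {..<K})"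
    using finite_same_card_bij[of "{K..<L}" "{..<L} - f ` {..<K}"] by auto
  define M where "M = \<Prod>{q. 0 < q \<and> q \<le> L\<^sup>2 \<and> coprime q L}"
  have fin: "finite {q. 0 < q \<and> q \<le> L\<^sup>2 \<and> coprime q L}"
    by (rule finite_subset[of _ "{..L\<^sup>2}"]) auto
  have M: "coprime M L" "0 < M"
    unfolding M_def by (auto intro!: prod_coprime_left prod_pos)
  have qM: "q dvd M" if "0 < q" "q \<le> L\<^sup>2" "coprime q L" for q
    unfolding M_def using that fin by (intro dvd_prodI[where f = "\<lambda>q. q", OF fin]) auto
  \<comment> \<open>From \<open>L\<close> on only growth is asked: those values are chosen anew at
    the next stage.\<close>
  define P where "P n x \<longleftrightarrow> (if n < K then x = f n
      else if n < L then [x = n] (mod M) \<and> [x = h n] (mod L) else True)" for n x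
  have "\<exists>g. \<forall>n. P n (g n) \<and> (n + 2) ^ 5 * g n \<le> g (Suc n)"
  proof (rule dependent_nat_choice)
    show "\<exists>x. P 0 x"
      using assms(2) by (simp add: P_def)
  next
    fix x n
    assume Px: "P n x"
    show "\<exists>y. P (Suc n) y \<and> (n + 2) ^ 5 * x \<le> y"
    proof (cases "Suc n < K")
      case True
      then show ?thesis
        using Px f by (auto simp: P_def rapidly_growing_def)
    next
      case False
      obtain y where "(n + 2) ^ 5 * x \<le> y" "[y = Suc n] (mod M)" "[y = h (Suc n)] (mod L)"
        using chinese_remainder_above[OF M(1) M(2) prime_gt_0_nat[OF L(1)]] by blast
      then show ?thesis
        using False by (auto simp: P_def)
    qed
  qed
  then obtain g where g: "\<And>n. P n (g n)" "\<And>n. (n + 2) ^ 5 * g n \<le> g (Suc n)"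
    by blast
  have g_f: "g i = f i" if "i < K" for i
    using g(1)[of i] that by (simp add: P_def)
  have g_new: "[g i = i] (mod M)" "[g i = h i] (mod L)" if "K \<le> i" "i < L" for i
    using g(1)[of i] that by (simp_all add: P_def)
  have "rapidly_growing g"
    using g(2) g_f[OF assms(2)] f by (simp add: rapidly_growing_def)
  moreover have "covers_residues g {..<L} L"
    unfolding covers_residues_def
  proof
    fix r
    have rL: "r mod L < L"
      using prime_gt_0_nat[OF L(1)] by simp
    show "\<exists>i\<in>{..<L}. [g i = r] (mod L)"
    proof (cases "r mod L \<in> f ` {..<K}")
      case True
      then obtain i where "i < K" "r mod L = f i"
        by auto
      then have "[g i = r] (mod L)"
        using g_f[of i] fL[of i] by (simp add: cong_def)
      then show ?thesis
        using \<open>i < K\<close> KL by (intro bexI[of _ i]) auto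
    next
      case False
      then have "r mod L \<in> h ` {K..<L}"
        using rL bij_betw_imp_surj_on[OF h] by auto
      then obtain i where "K \<le> i" "i < L" "r mod L = h i"
        by auto
      then have "[g i = r] (mod L)"
        using g_new(2)[of i] by (metis cong_def mod_mod_trivial)
      then show ?thesis
        using \<open>i < L\<close> by blast
    qed
  qed
  moreover have "[g i = i] (mod q)"
    if "K \<le> i" "i < L" "0 < q" "q \<le> L\<^sup>2" "coprime q L" for i q
    using g_new(1)[OF that(1,2)] qM[OF that(3-5)] by (rule cong_dvd_modulus_nat)
  ultimately show ?thesis
    using L g_f unfolding next_stage_def by auto
qed

text \<open>The stages have a diagonal limit, since values at indices below \<open>K j\<close> are
  final from stage \<open>j\<close> on and \<open>next_stage\<close> constrains only values below
  its \<open>L\<close>.\<close>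

lemma stages_exist:
  "\<exists>a K. rapidly_growing a \<and> 0 < K 0 \<and> (\<forall>j. next_stage a (K j) a (K (Suc j)))"
proof -
  \<comment> \<open>The starting sequence satisfies the growth condition with equality.\<close>
  have fact: "rapidly_growing (\<lambda>n. fact (Suc n) ^ 5)"
    unfolding rapidly_growing_def fact_Suc[of "Suc _"] power_mult_distrib by simp
  have "\<exists>s. \<forall>n. (rapidly_growing (fst (s n)) \<and> 0 < snd (s n)) \<and>
      next_stage (fst (s n)) (snd (s n)) (fst (s (Suc n))) (snd (s (Suc n)))"
  proof (rule dependent_nat_choice)
    show "\<exists>x. rapidly_growing (fst x) \<and> 0 < (snd x :: nat)"
      using fact by (intro exI[of _ "(\<lambda>n. fact (Suc n) ^ 5, 1)"]) simp
  next
    fix x :: "(nat \<Rightarrow> nat) \<times> nat" and n :: nat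
    assume "rapidly_growing (fst x) \<and> 0 < snd x"
    then obtain g L where "rapidly_growing g" "next_stage (fst x) (snd x) g L"
      using next_stage_exists by blast
    moreover from this have "0 < L"
      by (auto simp: next_stage_def intro: prime_gt_0_nat)
    ultimately show "\<exists>y. (rapidly_growing (fst y) \<and> 0 < snd y) \<and>
        next_stage (fst x) (snd x) (fst y) (snd y)"
      by (intro exI[of _ "(g, L)"]) simp
  qed
  then obtain s where s: "\<And>n. rapidly_growing (fst (s n))" "\<And>n. 0 < snd (s n)"
      "\<And>n. next_stage (fst (s n)) (snd (s n)) (fst (s (Suc n))) (snd (s (Suc n)))"
    by blast
  define f where "f n = fst (s n)" for n
  define K where "K n = snd (s n)" for n
  have f: "rapidly_growing (f n)" and K0: "0 < K n"
    and fK: "next_stage (f n) (K n) (f (Suc n)) (K (Suc n))" for n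
    using s unfolding f_def K_def by auto
  have "K n < K (Suc n)" for n
  proof -
    have "K n \<le> (K n)\<^sup>2" by (simp add: power2_eq_square)
    also have "\<dots> < K (Suc n)" using fK[of n] by (simp add: next_stage_def)
    finally show ?thesis .
  qed
  then have K: "strict_mono K"
    by (simp add: strict_mono_Suc_iff)
  \<comment> \<open>As \<open>K\<close> is strictly increasing, \<open>i < K (Suc i)\<close>, so
    this value is already final.\<close>
  define a where "a i = f (Suc i) i" for i
  have agree_add: "f (j + d) i = f j i" if "i < K j" for i j d
  proof (induction d)
    case (Suc d)
    have "i < K (j + d)"
      using that K by (meson le_add1 order_less_le_trans strict_mono_less_eq)
    then have "f (Suc (j + d)) i = f (j + d) i"
      using fK[of "j + d"] by (simp add: next_stage_def)
    then show ?case
      using Suc by simp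
  qed simp
  have agree: "f j i = a i" if "i < K j" for i j
  proof -
    have "i < K (Suc i)"
      using strict_mono_imp_increasing[OF K, of "Suc i"] by linarith
    then show ?thesis
      using agree_add[OF that, of "Suc i"] agree_add[of i "Suc i" j]
      unfolding a_def by (simp add: add.commute)
  qed
  have "(n + 2) ^ 5 * a n \<le> a (Suc n)" for n
  proof -
    have "Suc n < K (n + 2)"
      using strict_mono_imp_increasing[OF K, of "n + 2"] by linarith
    then have "f (n + 2) n = a n" "f (n + 2) (Suc n) = a (Suc n)"
      by (auto intro!: agree)
    then show ?thesis
      using f[of "n + 2"] unfolding rapidly_growing_def by metis
  qed
  then have "rapidly_growing a"
    using rapidly_growing_pos[OF f, of 1 0] by (simp add: rapidly_growing_def a_def)
  moreover have "next_stage a (K j) a (K (Suc j))" for j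
    using fK[of j] agree[of _ "Suc j"] unfolding next_stage_def covers_residues_def
    by (metis lessThan_iff)
  ultimately show ?thesis
    using K0 by blast
qed

section \<open>The largest modulus covered by an initial segment\<close>

text \<open>This is the modulus \<open>q\<close> used with \<open>k = n + 1\<close> elements.
  Modulus 1 always qualifies, so the maximum is taken over a nonempty set.\<close>

definition max_modulus :: "(nat \<Rightarrow> nat) \<Rightarrow> nat \<Rightarrow> nat" where
  "max_modulus a n = Max {q. 0 < q \<and> q \<le> n + 1 \<and> covers_residues a {..<n + 1} q}"

lemma max_modulus:
  shows max_modulus_pos: "0 < max_modulus a n"
    and max_modulus_le: "max_modulus a n \<le> n + 1"
    and max_modulus_covers: "covers_residues a {..<n + 1} (max_modulus a n)"
    and max_modulus_ge:
      "\<And>q. \<lbrakk>0 < q; q \<le> n + 1; covers_residues a {..<n + 1} q\<rbrakk> \<Longrightarrow> q \<le> max_modulus a n"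
proof -
  let ?Q = "{q. 0 < q \<and> q \<le> n + 1 \<and> covers_residues a {..<n + 1} q}"
  have fin: "finite ?Q"
    by (rule finite_subset[of _ "{..n + 1}"]) auto
  have "1 \<in> ?Q"
    by (auto simp: covers_residues_def cong_def)
  then have "max_modulus a n \<in> ?Q"
    unfolding max_modulus_def using fin by (intro Max_in) blast+
  then show "0 < max_modulus a n" "max_modulus a n \<le> n + 1"
      "covers_residues a {..<n + 1} (max_modulus a n)"
    by auto
  show "q \<le> max_modulus a n" if "0 < q" "q \<le> n + 1" "covers_residues a {..<n + 1} q" for q
    unfolding max_modulus_def using fin that by (intro Max_ge) auto
qed

lemma strict_mono_bracket:
  fixes K :: "nat \<Rightarrow> nat"
  assumes "strict_mono K" and "K m \<le> x"
  shows "\<exists>j\<ge>m. K j \<le> x \<and> x < K (Suc j)"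
proof -
  let ?j = "GREATEST j. K j \<le> x"
  have bd: "j \<le> x" if "K j \<le> x" for j
    using that strict_mono_imp_increasing[OF assms(1), of j] by linarith
  have "K ?j \<le> x"
    using assms(2) bd by (rule GreatestI_nat)
  moreover have "m \<le> ?j"
    using assms(2) bd by (rule Greatest_le_nat)
  moreover have "x < K (Suc ?j)"
  proof (rule ccontr)
    assume "\<not> x < K (Suc ?j)"
    then have "K (Suc ?j) \<le> x" by simp
    then have "Suc ?j \<le> ?j" using bd by (rule Greatest_le_nat)
    then show False by simp
  qed
  ultimately show ?thesis
    by blast
qed

text \<open>Equality occurs at each prime \<open>n + 1 = K (Suc j)\<close>. For general
  \<open>k\<close>, discarding a suitable number \<open>s\<close> of elements, at most the square
  root of \<open>k\<close>, leaves indices on which \<open>a i\<close> is congruent to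
  \<open>i\<close> modulo \<open>k - s\<close> or \<open>k - s - 1\<close>.\<close>

lemma economical_sequence_exists:
  "\<exists>a. rapidly_growing a \<and> (\<exists>\<^sub>F n in sequentially. max_modulus a n = n + 1) \<and>
    ((\<lambda>n. real (max_modulus a n) / real (n + 1)) \<longlonglongrightarrow> 1)"
proof -
  obtain a K where a: "rapidly_growing a" and K0: "0 < K 0"
    and stage: "\<And>j. next_stage a (K j) a (K (Suc j))"
    using stages_exist by blast
  have sq: "(K j)\<^sup>2 < K (Suc j)" and prime: "prime (K (Suc j))"
    and cov: "covers_residues a {..<K (Suc j)} (K (Suc j))"
    and cong: "\<And>i q. \<lbrakk>K j \<le> i; i < K (Suc j); 0 < q; q \<le> (K (Suc j))\<^sup>2; coprime q (K (Suc j))\<rbrakk>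
        \<Longrightarrow> [a i = i] (mod q)" for j
    using stage[of j] unfolding next_stage_def by blast+
  have "K j < K (Suc j)" for j
  proof -
    have "K j \<le> (K j)\<^sup>2" by (simp add: power2_eq_square)
    also have "\<dots> < K (Suc j)" by (rule sq)
    finally show ?thesis .
  qed
  then have mono: "strict_mono K"
    by (simp add: strict_mono_Suc_iff)
  have "\<exists>n\<ge>m. max_modulus a n = n + 1" for m
  proof -
    let ?L = "K (Suc (m + 1))"
    have L: "m + 1 < ?L"
      using strict_mono_imp_increasing[OF mono, of "Suc (m + 1)"] by linarith
    then have "?L \<le> max_modulus a (?L - 1)"
      using cov[of "m + 1"] by (intro max_modulus_ge) auto
    then have "max_modulus a (?L - 1) = ?L - 1 + 1"
      using L max_modulus_le[of a "?L - 1"] by simp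
    then show ?thesis
      using L by (intro exI[of _ "?L - 1"]) simp
  qed
  then have freq: "\<exists>\<^sub>F n in sequentially. max_modulus a n = n + 1"
    by (simp add: frequently_sequentially)
  have lower: "real k - sqrt (real k) - 1 \<le> real (max_modulus a (k - 1))" if "K 1 \<le> k" for k
  proof -
    obtain j where j: "1 \<le> j" "K j \<le> k" "k < K (Suc j)"
      using strict_mono_bracket[OF mono \<open>K 1 \<le> k\<close>] by blast
    then obtain l where l: "j = Suc l"
      by (cases j) auto
    have "0 < K j"
      using prime[of l] l prime_gt_0_nat by simp
    then have k0: "0 < k"
      using j(2) by linarith
    have Klt: "q < K (Suc j) \<Longrightarrow> 0 < q \<Longrightarrow> coprime q (K (Suc j))" for q
      using prime[of j] by (metis coprime_commute nat_dvd_not_less prime_imp_coprime)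
    have Kle: "q < K (Suc j) \<Longrightarrow> q \<le> (K (Suc j))\<^sup>2" for q
      by (simp add: power2_eq_square trans_le_add1 order.strict_implies_order)
        (metis less_imp_le_nat le_square order_trans)
    \<comment> \<open>The first \<open>s\<close> elements, fixed too long ago to be controlled modulo \<open>q\<close>, are discarded.\<close>
    have "\<exists>s q. s\<^sup>2 \<le> k \<and> k \<le> s + q + 1 \<and> s + q \<le> k \<and>
        (0 < q \<longrightarrow> (\<forall>i. s \<le> i \<longrightarrow> i < k \<longrightarrow> [a i = i] (mod q)))"
    \<comment> \<open>Up to \<open>(K j)\<^sup>2\<close> the elements from index \<open>K l\<close>
      on are usable, provided that \<open>q\<close> is coprime to the prime \<open>K j\<close>.
      Beyond it, discarding all \<open>K j\<close> earlier elements is cheap enough, and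
      \<open>q < K (Suc j)\<close> gives coprimality to the next prime.\<close>
    proof (cases "k \<le> (K j)\<^sup>2")
      case True
      have sl: "(K l)\<^sup>2 < K j"
        using sq[of l] l by simp
      have "K l \<le> (K l)\<^sup>2"
        by (simp add: power2_eq_square)
      then have lk: "K l < k"
        using sl j(2) by linarith
      \<comment> \<open>A prime cannot divide two consecutive integers, so lowering \<open>q\<close>
        by at most one makes it coprime to \<open>K j\<close>.\<close>
      obtain q where q: "q = k - K l \<or> q = k - K l - 1" "q = 0 \<or> \<not> K j dvd q"
      proof (cases "K j dvd k - K l")
        case True
        have "\<not> K j dvd k - K l - 1" if "k - K l - 1 \<noteq> 0"
        proof
          assume "K j dvd k - K l - 1"
          with True have "K j dvd (k - K l) - (k - K l - 1)"
            by (rule dvd_diff_nat)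
          then have "K j dvd 1"
            using that by simp
          then show False
            using prime[of l] l by (simp add: not_prime_1)
        qed
        then have "k - K l - 1 = 0 \<or> \<not> K j dvd k - K l - 1"
          by blast
        then show ?thesis
          by (rule that[OF disjI2[OF refl]])
      qed (use that in blast)
      have "[a i = i] (mod q)" if "0 < q" "K l \<le> i" "i < k" for i
      proof (cases "i < K j")
        case True
        have "coprime q (K j)"
          using q(2) that(1) prime[of l] l by (metis coprime_commute not_gr0 prime_imp_coprime)
        moreover have "q \<le> (K j)\<^sup>2"
          using q(1) \<open>k \<le> (K j)\<^sup>2\<close> by linarith
        ultimately show ?thesis
          using cong[of l i q] that True l by simp
      next
        case False
        have "q < K (Suc j)"
          using q(1) j(3) by linarith
        then show ?thesis
          using cong[of j i q] that False j(3) Klt Kle by simp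
      qed
      moreover have "(K l)\<^sup>2 \<le> k" "k \<le> K l + q + 1" "K l + q \<le> k"
        using sl j(2) q(1) lk by linarith+
      ultimately show ?thesis
        by blast
    next
      case False
      have "[a i = i] (mod k - K j)" if "0 < k - K j" "K j \<le> i" "i < k" for i
        using cong[of j i "k - K j"] that j(3) Klt Kle by simp
      then show ?thesis
        using False j(2) by (intro exI[of _ "K j"] exI[of _ "k - K j"]) auto
    qed
    then obtain s q where sq: "s\<^sup>2 \<le> k" "k \<le> s + q + 1" "s + q \<le> k"
        "0 < q \<longrightarrow> (\<forall>i. s \<le> i \<longrightarrow> i < k \<longrightarrow> [a i = i] (mod q))"
      by blast
    have "q \<le> max_modulus a (k - 1)"
    proof (cases "q = 0")
      case False
      then have "covers_residues a {..<k} q"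
        using sq by (intro covers_residues_consecutive[of s]) auto
      then show ?thesis
        using False k0 sq(3) by (intro max_modulus_ge) auto
    qed simp
    moreover have "real s \<le> sqrt (real k)"
      using sq(1) by (simp add: real_le_rsqrt flip: of_nat_power)
    ultimately show ?thesis
      using sq(2) by linarith
  qed
  have "(\<lambda>n. real (max_modulus a n) / real (n + 1)) \<longlonglongrightarrow> 1"
  proof (rule tendsto_sandwich)
    show "\<forall>\<^sub>F n in sequentially. (real (n + 1) - sqrt (real (n + 1)) - 1) / real (n + 1)
        \<le> real (max_modulus a n) / real (n + 1)"
      using eventually_ge_at_top[of "K 1"]
    proof eventually_elim
      case (elim n)
      then show ?case
        using lower[of "n + 1"] by (intro divide_right_mono) auto
    qed
    show "\<forall>\<^sub>F n in sequentially. real (max_modulus a n) / real (n + 1) \<le> 1"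
      using max_modulus_le[of a] by (intro always_eventually allI) (simp flip: of_nat_Suc)
    show "(\<lambda>n. (real (n + 1) - sqrt (real (n + 1)) - 1) / real (n + 1)) \<longlonglongrightarrow> 1"
      by real_asymp
  qed simp
  then show ?thesis
    using a freq by blast
qed

section \<open>The complement\<close>

text \<open>Indices start from 0 here, so \<open>a n\<close> is the element \<open>a\<^bsub>n+1\<^esub>\<close> of the informal notation and
  \<open>n * a n\<close> is \<open>(n + 1) * a n\<close>, the start of the new range, less the overlap \<open>a n\<close>.\<close>
definition complement_of :: "(nat \<Rightarrow> nat) \<Rightarrow> nat set" where
  "complement_of a = {b. 0 < b \<and>
     (\<exists>n. max_modulus a n dvd b \<and> n * a n \<le> b \<and> b < (n + 2) * a (Suc n))}"

section \<open>Counting multiples in an interval\<close>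

lemma card_multiples_le:
  fixes p :: nat
  assumes "0 < p" and "0 \<le> y"
  shows "real (card {b. p dvd b \<and> 0 < b \<and> real b \<le> y}) \<le> y / real p"
proof -
  have "{b. p dvd b \<and> 0 < b \<and> real b \<le> y} \<subseteq> (\<lambda>c. p * c) ` {1..nat \<lfloor>y / real p\<rfloor>}"
  proof
    fix b
    assume b: "b \<in> {b. p dvd b \<and> 0 < b \<and> real b \<le> y}"
    then obtain c where c: "b = p * c"
      by auto
    then have "real c \<le> y / real p"
      using b assms by (simp add: field_simps)
    then have "c \<le> nat \<lfloor>y / real p\<rfloor>"
      by (simp add: le_nat_floor)
    then show "b \<in> (\<lambda>c. p * c) ` {1..nat \<lfloor>y / real p\<rfloor>}"
      using b c by auto
  qed
  then have "card {b. p dvd b \<and> 0 < b \<and> real b \<le> y} \<le> nat \<lfloor>y / real p\<rfloor>"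
    using surj_card_le[of "{1..nat \<lfloor>y / real p\<rfloor>}"] by fastforce
  then have "real (card {b. p dvd b \<and> 0 < b \<and> real b \<le> y}) \<le> real (nat \<lfloor>y / real p\<rfloor>)"
    by (rule of_nat_mono)
  also have "\<dots> \<le> y / real p"
    using assms by (intro of_nat_floor) simp
  finally show ?thesis .
qed

text \<open>Subtracting the least multiple \<open>m\<close> in the interval turns the others into
  positive multiples up to \<open>y - l\<close>; the summand 1 counts \<open>m\<close>
  itself.\<close>

lemma card_multiples_between_le:
  fixes p l :: nat
  assumes "0 < p" and "real l \<le> y"
  shows "real (card {b. p dvd b \<and> l \<le> b \<and> real b \<le> y}) \<le> (y - real l) / real p + 1"
proof (cases "{b. p dvd b \<and> l \<le> b \<and> real b \<le> y} = {}")
  case True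
  then show ?thesis
    unfolding True using assms by simp
next
  case False
  let ?S = "{b. p dvd b \<and> l \<le> b \<and> real b \<le> y}"
  let ?T = "{d. p dvd d \<and> 0 < d \<and> real d \<le> y - real l}"
  define m where "m = (LEAST b. b \<in> ?S)"
  have "\<exists>b. b \<in> ?S"
    using False by blast
  then have m: "m \<in> ?S"
    unfolding m_def by (rule LeastI_ex)
  have m_le: "m \<le> b" if "b \<in> ?S" for b
    unfolding m_def using that by (rule Least_le)
  have "?S \<subseteq> insert m ((\<lambda>d. m + d) ` ?T)"
  proof
    fix b
    assume b: "b \<in> ?S"
    show "b \<in> insert m ((\<lambda>d. m + d) ` ?T)"
    proof (cases "b = m")
      case False
      then have "m < b" using m_le[OF b] by simp
      then have "b - m \<in> ?T"
        using b m by (simp add: of_nat_diff dvd_diff_nat)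
      then show ?thesis
        using \<open>m < b\<close> by (intro insertI2 image_eqI[of _ _ "b - m"]) simp_all
    qed simp
  qed
  moreover have fin: "finite ?T"
    by (rule finite_subset[of _ "{..nat \<lfloor>y - real l\<rfloor>}"]) (auto intro!: le_nat_floor)
  ultimately have "card ?S \<le> card (insert m ((\<lambda>d. m + d) ` ?T))"
    by (intro card_mono) auto
  also have "\<dots> \<le> Suc (card ((\<lambda>d. m + d) ` ?T))"
    using fin by (simp add: card_insert_if)
  also have "\<dots> \<le> Suc (card ?T)"
    using card_image_le[OF fin] by simp
  finally show ?thesis
    using card_multiples_le[OF assms(1), of "y - real l"] assms(2) by simp
qed

section \<open>Counting function and largest element of the sequence\<close>

lemma rapidly_growing_bracket:
  assumes "rapidly_growing a" and "real (a m) \<le> x"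
  shows "\<exists>n\<ge>m. real (a n) \<le> x \<and> x < real (a (Suc n))"
proof -
  have x: "0 \<le> x" using assms(2) by (meson of_nat_0_le_iff order_trans)
  have "a m \<le> nat \<lfloor>x\<rfloor>"
    using assms(2) by (simp add: le_nat_floor)
  then obtain n where n: "m \<le> n" "a n \<le> nat \<lfloor>x\<rfloor>" "nat \<lfloor>x\<rfloor> < a (Suc n)"
    using strict_mono_bracket[OF rapidly_growing_strict_mono[OF assms(1)]] by blast
  have "real (a n) \<le> x"
    using n(2) x by linarith
  moreover have "x < real (a (Suc n))"
    using n(3) x by linarith
  ultimately show ?thesis
    using n(1) by blast
qed

lemma bracketed_range:
  assumes "rapidly_growing a" and "real (a n) \<le> x" and "x < real (a (Suc n))"
  shows "{m \<in> range a. 1 \<le> m \<and> real m \<le> x} = a ` {..n}"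
proof -
  note mono = rapidly_growing_strict_mono[OF assms(1)]
  have "real (a i) \<le> x \<longleftrightarrow> i \<le> n" for i
  proof
    assume "real (a i) \<le> x"
    then have "a i < a (Suc n)" using assms(3) by linarith
    then show "i \<le> n" using mono by (simp add: strict_mono_less)
  next
    assume "i \<le> n"
    then have "a i \<le> a n" using mono by (simp add: strict_mono_less_eq)
    then show "real (a i) \<le> x" using assms(2) by linarith
  qed
  then show ?thesis
    using rapidly_growing_pos[OF assms(1)] by (auto simp: Suc_le_eq)
qed

lemma counting_range:
  assumes "rapidly_growing a" and "real (a n) \<le> x" and "x < real (a (Suc n))"
  shows "counting (range a) x = n + 1"
  unfolding counting_def bracketed_range[OF assms]
  using rapidly_growing_strict_mono[OF assms(1)]
  by (subst card_image) (auto intro: inj_on_subset[OF strict_mono_imp_inj_on])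

lemma largest_upto_range:
  assumes "rapidly_growing a" and "real (a n) \<le> x" and "x < real (a (Suc n))"
  shows "largest_upto (range a) x = a n"
  unfolding largest_upto_def bracketed_range[OF assms]
  using rapidly_growing_strict_mono[OF assms(1)]
  by (intro Max_eqI) (auto simp: strict_mono_less_eq)

lemma nth_element_range:
  assumes "strict_mono a"
  shows "nth_element (range a) (Suc n) = a n"
proof -
  have "enumerate (range a) n = a n"
  proof (induction n)
    case 0
    show ?case
      unfolding enumerate_0 using assms
      by (intro Least_equality) (auto simp: strict_mono_less_eq)
  next
    case (Suc n)
    have "infinite (range a)"
      using assms by (simp add: range_inj_infinite strict_mono_imp_inj_on)
    then show ?case
      unfolding enumerate_Suc''[OF \<open>infinite (range a)\<close>] Suc using assms
      by (intro Least_equality) (auto simp: strict_mono_less strict_mono_less_eq Suc_le_eq)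
  qed
  then show ?thesis
    by (simp add: nth_element_def)
qed

section \<open>Upper bounds for the counting function of the complement\<close>

lemma finite_bounded_naturals: "finite {b \<in> S. (1::nat) \<le> b \<and> real b \<le> x}"
  by (rule finite_subset[of _ "{..nat \<lfloor>x\<rfloor>}"]) (auto intro!: le_nat_floor)

text \<open>Ranges of index above \<open>Suc n\<close> start beyond \<open>x\<close>, and those of
  index below \<open>n\<close> end by \<open>(n + 1) * a n\<close>. Only two progressions remain
  visible.\<close>

lemma complement_upto_cases:
  assumes "rapidly_growing a" and "x < real (a (Suc (Suc n)))"
    and "b \<in> complement_of a" and "real b \<le> x"
  shows "0 < b \<and> (b < (n + 1) * a n \<or> (max_modulus a n dvd b \<and> b < (n + 2) * a (Suc n)) \<or>
     (max_modulus a (Suc n) dvd b \<and> Suc n * a (Suc n) \<le> b))"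
proof -
  note mono = rapidly_growing_strict_mono[OF assms(1)]
  obtain k where k: "0 < b" "max_modulus a k dvd b" "k * a k \<le> b" "b < (k + 2) * a (Suc k)"
    using assms(3) by (auto simp: complement_of_def)
  have "k \<le> Suc n"
  proof (rule ccontr)
    assume "\<not> k \<le> Suc n"
    then have "a (Suc (Suc n)) \<le> a k" "1 \<le> k" using mono by (simp_all add: strict_mono_less_eq)
    then have "a (Suc (Suc n)) \<le> k * a k"
      by (metis mult_le_mono nat_mult_1)
    then show False using k(3) assms(2,4) by linarith
  qed
  then consider "k = Suc n" | "k = n" | "Suc k \<le> n" by linarith
  then show ?thesis
  proof cases
    case 3
    then have "(k + 2) * a (Suc k) \<le> (n + 1) * a n"
      using mono by (intro mult_le_mono) (simp_all add: strict_mono_less_eq)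
    then show ?thesis using k(1,4) by linarith
  qed (use k in auto)
qed

text \<open>Before range \<open>Suc n\<close> opens, a single progression counts. This sharp form is
  needed at \<open>x = a (Suc n)\<close>, where no overlap may be charged.\<close>

lemma counting_complement_before:
  assumes "rapidly_growing a" and "0 \<le> x"
    and "x < real (Suc n * a (Suc n))" and "x < real (a (Suc (Suc n)))"
  shows "real (counting (complement_of a) x) \<le> real ((n + 1) * a n) + x / real (max_modulus a n)"
proof -
  let ?M = "{b. max_modulus a n dvd b \<and> 0 < b \<and> real b \<le> x}"
  have fin: "finite ?M"
    by (rule finite_subset[OF _ finite_bounded_naturals[of UNIV x]]) (auto simp: Suc_le_eq)
  have "{b \<in> complement_of a. 1 \<le> b \<and> real b \<le> x} \<subseteq> {0<..<(n + 1) * a n} \<union> ?M"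
  proof
    fix b
    assume b: "b \<in> {b \<in> complement_of a. 1 \<le> b \<and> real b \<le> x}"
    then have "real b \<le> x"
      by simp
    also note assms(3)
    finally have "b < Suc n * a (Suc n)"
      by (simp only: of_nat_less_iff)
    then show "b \<in> {0<..<(n + 1) * a n} \<union> ?M"
      using complement_upto_cases[OF assms(1,4), of b] b by auto
  qed
  then have "counting (complement_of a) x \<le> card ({0<..<(n + 1) * a n} \<union> ?M)"
    unfolding counting_def using fin by (intro card_mono) auto
  also have "\<dots> \<le> (n + 1) * a n + card ?M"
    using card_Un_le[of "{0<..<(n + 1) * a n}" ?M] by simp
  finally have "real (counting (complement_of a) x) \<le> real ((n + 1) * a n) + real (card ?M)"
    unfolding of_nat_add[symmetric] by (rule of_nat_mono)
  then show ?thesis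
    using card_multiples_le[OF max_modulus_pos assms(2), of a n] by linarith
qed

text \<open>Past the start of range \<open>Suc n\<close>, the two ranges have total length
  \<open>x\<close> plus their overlap \<open>a (Suc n)\<close>, which is at most
  \<open>x / (n + 1)\<close>. The common lower bound \<open>P\<close> lets both progressions be
  counted with one density.\<close>

lemma counting_complement_le:
  assumes "rapidly_growing a"
    and "real (a (Suc n)) \<le> x" and "x < real (a (Suc (Suc n)))"
    and "0 < P" and "P \<le> max_modulus a n" and "P \<le> max_modulus a (Suc n)"
  shows "real (counting (complement_of a) x)
    \<le> real ((n + 1) * a n) + x / real P * (1 + 1 / real (n + 1)) + 1"
proof (cases "x < real (Suc n * a (Suc n))")
  case True
  have x: "0 \<le> x" using assms(2) by (meson of_nat_0_le_iff order_trans)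
  have "x / real (max_modulus a n) \<le> x / real P"
    using assms(4,5) x by (intro divide_left_mono) auto
  moreover have "x / real P \<le> x / real P * (1 + 1 / real (n + 1))"
    using x by (simp add: algebra_simps)
  ultimately show ?thesis
    using counting_complement_before[OF assms(1) x True assms(3)] by linarith
next
  case False
  then have x: "real (Suc n * a (Suc n)) \<le> x" by simp
  let ?u = "real ((n + 2) * a (Suc n))"
  let ?M = "{b. max_modulus a n dvd b \<and> 0 < b \<and> real b \<le> ?u}"
  let ?N = "{b. max_modulus a (Suc n) dvd b \<and> Suc n * a (Suc n) \<le> b \<and> real b \<le> x}"
  have fin: "finite {b. max_modulus a k dvd b \<and> Q b \<and> real b \<le> y}" for k Q y
    by (rule finite_subset[of _ "{..nat \<lfloor>y\<rfloor>}"]) (auto intro!: le_nat_floor)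
  have "{b \<in> complement_of a. 1 \<le> b \<and> real b \<le> x} \<subseteq> {0<..<(n + 1) * a n} \<union> (?M \<union> ?N)"
  proof
    fix b
    assume "b \<in> {b \<in> complement_of a. 1 \<le> b \<and> real b \<le> x}"
    then show "b \<in> {0<..<(n + 1) * a n} \<union> (?M \<union> ?N)"
      using complement_upto_cases[OF assms(1,3), of b] of_nat_mono[of b "(n + 2) * a (Suc n)"]
      by (auto simp del: of_nat_mult of_nat_add)
  qed
  then have "counting (complement_of a) x \<le> card ({0<..<(n + 1) * a n} \<union> (?M \<union> ?N))"
    unfolding counting_def using fin by (intro card_mono) auto
  also have "\<dots> \<le> (n + 1) * a n + (card ?M + card ?N)"
    using card_Un_le[of "{0<..<(n + 1) * a n}" "?M \<union> ?N"] card_Un_le[of ?M ?N] by simp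
  finally have "real (counting (complement_of a) x)
      \<le> real ((n + 1) * a n) + (real (card ?M) + real (card ?N))"
    unfolding of_nat_add[symmetric] by (rule of_nat_mono)
  moreover have "real (card ?M) \<le> ?u / real P"
  proof -
    have "real (card ?M) \<le> ?u / real (max_modulus a n)"
      by (rule card_multiples_le[OF max_modulus_pos]) simp
    also have "\<dots> \<le> ?u / real P"
      using assms(4,5) by (intro divide_left_mono) auto
    finally show ?thesis .
  qed
  moreover have "real (card ?N) \<le> (x - real (Suc n * a (Suc n))) / real P + 1"
  proof -
    have "real (card ?N) \<le> (x - real (Suc n * a (Suc n))) / real (max_modulus a (Suc n)) + 1"
      using x by (rule card_multiples_between_le[OF max_modulus_pos])
    also have "\<dots> \<le> (x - real (Suc n * a (Suc n))) / real P + 1"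
      using assms(4,6) x by (intro add_right_mono divide_left_mono) auto
    finally show ?thesis .
  qed
  \<comment> \<open>The old range ends at \<open>(n + 2) * a (Suc n)\<close> and the new one starts
    at \<open>(n + 1) * a (Suc n)\<close>; the difference is the overlap.\<close>
  moreover have "?u / real P + (x - real (Suc n * a (Suc n))) / real P
      = (x + real (a (Suc n))) / real P"
    by (simp add: add_divide_distrib[symmetric] algebra_simps)
  moreover have "(x + real (a (Suc n))) / real P \<le> x / real P * (1 + 1 / real (n + 1))"
  proof -
    have "real (a (Suc n)) \<le> x / real (n + 1)"
      using x by (simp add: field_simps)
    then have "(x + real (a (Suc n))) / real P \<le> (x + x / real (n + 1)) / real P"
      by (intro divide_right_mono) auto
    also have "\<dots> = x / real P * (1 + 1 / real (n + 1))"
      by (simp add: field_simps)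
    finally show ?thesis .
  qed
  ultimately show ?thesis
    by linarith
qed

section \<open>Covering and exactness\<close>

text \<open>For \<open>m\<close> between \<open>(n + 1) * a n\<close> and
  \<open>(n + 2) * a (Suc n)\<close>, some \<open>a i \<le> a n\<close> has the residue of
  \<open>m\<close>. Since range \<open>n\<close> starts earlier by \<open>a n\<close>, it still
  contains \<open>m - a i\<close>.\<close>

lemma complement_covers:
  assumes "rapidly_growing a" and "2 * a 1 \<le> m"
  shows "m \<in> range a + complement_of a"
proof -
  note mono = rapidly_growing_strict_mono[OF assms(1)]
  have "(n + 1) * a n < (n + 2) * a (Suc n)" for n
  proof -
    have "a n < a (Suc n)"
      using mono by (simp add: strict_mono_less)
    then show ?thesis
      by (intro mult_strict_mono) simp_all
  qed
  then have "strict_mono (\<lambda>n. (n + 1) * a n)"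
    by (simp add: strict_mono_Suc_iff)
  \<comment> \<open>The threshold \<open>2 * a 1\<close> is \<open>(n + 1) * a n\<close> at
    \<open>n = 1\<close>; having \<open>1 \<le> n\<close> keeps \<open>m - a i\<close>
    positive.\<close>
  then obtain n where n: "1 \<le> n" "(n + 1) * a n \<le> m" "m < (Suc n + 1) * a (Suc n)"
    using strict_mono_bracket[of "\<lambda>n. (n + 1) * a n" 1 m] assms(2) by auto
  have "\<exists>i\<in>{..<n + 1}. [a i = m] (mod max_modulus a n)"
    using max_modulus_covers[of a n] unfolding covers_residues_def ..
  then obtain i where i: "i \<le> n" "[a i = m] (mod max_modulus a n)"
    by (auto simp: less_Suc_eq_le)
  have ai: "a i \<le> a n"
    using mono i(1) by (simp add: strict_mono_less_eq)
  have lower: "n * a n + a n \<le> m"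
    using n(2) by simp
  have "0 < n * a n"
    using n(1) rapidly_growing_pos[OF assms(1), of n] by simp
  then have "0 < m - a i" "n * a n \<le> m - a i" "a i \<le> m"
    using ai lower by linarith+
  moreover have "m - a i < (n + 2) * a (Suc n)"
    using n(3) by simp
  moreover have "max_modulus a n dvd m - a i"
    using i(2) \<open>a i \<le> m\<close> by (metis cong_altdef_nat cong_sym)
  ultimately have "m - a i \<in> complement_of a"
    unfolding complement_of_def by blast
  then have "a i + (m - a i) \<in> range a + complement_of a"
    by (intro set_plus_intro) auto
  then show ?thesis
    using \<open>a i \<le> m\<close> by simp
qed

text \<open>Both summands of a sum below \<open>x\<close> are below \<open>x\<close>, so pairs of
  counted elements are at least as many as the sums they must produce.\<close>

lemma counting_product_ge:
  assumes "A \<subseteq> {0<..}" and "B \<subseteq> {0<..}" and "\<And>m. C \<le> m \<Longrightarrow> m \<in> A + B"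
  shows "x - real (C + 1) \<le> real (counting A x) * real (counting B x)"
proof -
  let ?A = "{n \<in> A. 1 \<le> n \<and> real n \<le> x}" and ?B = "{n \<in> B. 1 \<le> n \<and> real n \<le> x}"
  have "{C..<nat \<lfloor>x\<rfloor>} \<subseteq> (\<lambda>(u, v). u + v) ` (?A \<times> ?B)"
  proof
    fix m
    assume m: "m \<in> {C..<nat \<lfloor>x\<rfloor>}"
    then obtain u v where uv: "m = u + v" "u \<in> A" "v \<in> B"
      using assms(3)[of m] by (auto elim: set_plus_elim)
    have "real m \<le> x"
      using m unfolding atLeastLessThan_iff by linarith
    then have "u \<in> ?A" "v \<in> ?B"
      using uv assms(1,2) by (auto simp: Suc_le_eq)
    then show "m \<in> (\<lambda>(u, v). u + v) ` (?A \<times> ?B)"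
      using uv(1) by force
  qed
  then have "card {C..<nat \<lfloor>x\<rfloor>} \<le> card (?A \<times> ?B)"
    by (rule surj_card_le[rotated]) (intro finite_cartesian_product finite_bounded_naturals)
  then have "real (nat \<lfloor>x\<rfloor> - C) \<le> real (counting A x) * real (counting B x)"
    by (simp add: card_cartesian_product counting_def flip: of_nat_mult)
  \<comment> \<open>The extra 1 pays for rounding \<open>x\<close> down.\<close>
  moreover have "x - real (C + 1) \<le> real (nat \<lfloor>x\<rfloor> - C)"
    by linarith
  ultimately show ?thesis
    by linarith
qed

lemma counting_range_at_top:
  assumes "rapidly_growing a"
  shows "filterlim (counting (range a)) at_top at_top"
  unfolding filterlim_at_top
proof
  fix m
  show "\<forall>\<^sub>F x in at_top. m \<le> counting (range a) x"
    using eventually_ge_at_top[of "real (a m)"]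
  proof eventually_elim
    case (elim x)
    then obtain n where "m \<le> n" "real (a n) \<le> x" "x < real (a (Suc n))"
      using rapidly_growing_bracket[OF assms] by blast
    then show ?case
      using counting_range[OF assms] by simp
  qed
qed

lemma growth_bound:
  assumes "rapidly_growing a"
  shows "real (n + 2) ^ 5 * real (a n) \<le> real (a (Suc n))"
proof -
  have "(n + 2) ^ 5 * a n \<le> a (Suc n)"
    using assms by (simp add: rapidly_growing_def)
  then have "real ((n + 2) ^ 5 * a n) \<le> real (a (Suc n))"
    by (rule of_nat_mono)
  then show ?thesis
    by simp
qed

text \<open>The covering property bounds the quotient from below. From above it is bounded by
  \<open>U\<close>, which tends to 1 because consecutive maximal moduli are both asymptotic to
  \<open>n\<close>.\<close>

lemma complement_exact:
  assumes a: "rapidly_growing a"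
    and lim: "(\<lambda>n. real (max_modulus a n) / real (n + 1)) \<longlonglongrightarrow> 1"
  shows "exact_additive_complements (range a) (complement_of a)"
proof -
  let ?A = "range a" and ?B = "complement_of a"
  have pos: "?A \<subseteq> {0<..}" "?B \<subseteq> {0<..}"
    using rapidly_growing_pos[OF a] by (auto simp: complement_of_def)
  have cov: "m \<in> ?A + ?B" if "2 * a 1 \<le> m" for m
    using complement_covers[OF a that] .
  define P where "P n = min (max_modulus a n) (max_modulus a (Suc n))" for n
  \<comment> \<open>The terms bound the shares of the stray elements, of the two active progressions
    and of the additive 1 in the bound for the complement, after multiplication by
    \<open>A(x) = n + 2\<close> and division by \<open>x\<close>.\<close>
  define U where "U n = 1 / real (n + 2) + real (n + 2) / real (P n) * (1 + 1 / real (n + 1))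
      + real (n + 2) / real (n + 2) ^ 5" for n
  have "(\<lambda>n. real (max_modulus a n) / real (n + 1) * (real (n + 1) / real (n + 2))) \<longlonglongrightarrow> 1 * 1"
    by (intro tendsto_mult lim) real_asymp
  then have l1: "(\<lambda>n. real (max_modulus a n) / real (n + 2)) \<longlonglongrightarrow> 1"
    by simp
  have l2: "(\<lambda>n. real (max_modulus a (Suc n)) / real (n + 2)) \<longlonglongrightarrow> 1"
    using LIMSEQ_Suc[OF lim] by simp
  have "(\<lambda>n. min (real (max_modulus a n) / real (n + 2))
      (real (max_modulus a (Suc n)) / real (n + 2))) \<longlonglongrightarrow> min 1 1"
    by (intro tendsto_min l1 l2)
  moreover have "min (real (max_modulus a n) / real (n + 2))
      (real (max_modulus a (Suc n)) / real (n + 2)) = real (P n) / real (n + 2)" for n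
    unfolding P_def by (simp add: min_def divide_le_cancel)
  ultimately have "(\<lambda>n. real (P n) / real (n + 2)) \<longlonglongrightarrow> 1"
    by simp
  then have "(\<lambda>n. inverse (real (P n) / real (n + 2))) \<longlonglongrightarrow> inverse 1"
    by (intro tendsto_inverse) simp_all
  then have P: "(\<lambda>n. real (n + 2) / real (P n)) \<longlonglongrightarrow> 1"
    by simp
  have "U \<longlonglongrightarrow> 0 + 1 * 1 + 0"
    unfolding U_def by (intro tendsto_add tendsto_mult P) real_asymp+
  then have U: "U \<longlonglongrightarrow> 1"
    by simp
  \<comment> \<open>Since \<open>A(x) = n + 2\<close>, subtracting 2 recovers the stage
    \<open>n\<close> from \<open>x\<close>.\<close>
  have "((\<lambda>x. U (counting ?A x - 2)) \<longlongrightarrow> 1) at_top"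
    by (rule filterlim_compose[OF U filterlim_compose[OF filterlim_minus_const_nat_at_top
          counting_range_at_top[OF a]]])
  have upper: "real (counting ?A x) * real (counting ?B x) / x \<le> U (counting ?A x - 2)"
    if x: "real (a 1) \<le> x" for x
  proof -
    obtain n where n: "real (a (Suc n)) \<le> x" "x < real (a (Suc (Suc n)))"
      using rapidly_growing_bracket[OF a x] by (metis One_nat_def Suc_le_D)
    have A: "counting ?A x = n + 2"
      using counting_range[OF a n] by simp
    have Pn: "0 < P n" "P n \<le> max_modulus a n" "P n \<le> max_modulus a (Suc n)"
      by (simp_all add: P_def max_modulus_pos)
    have B: "real (counting ?B x)
        \<le> real ((n + 1) * a n) + x / real (P n) * (1 + 1 / real (n + 1)) + 1"
      by (rule counting_complement_le[OF a n Pn])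
    have x5: "real (n + 2) ^ 5 * real (a n) \<le> x"
      using growth_bound[OF a, of n] n(1) by linarith
    have an: "1 \<le> real (a n)"
      using rapidly_growing_pos[OF a, of n] by simp
    have x0: "0 < x"
      using n(1) rapidly_growing_pos[OF a, of "Suc n"] by linarith
    have "real (n + 2) * real ((n + 1) * a n) / x \<le> 1 / real (n + 2)"
    proof -
      have "real (n + 2) * real ((n + 1) * a n) * real (n + 2) \<le> real (n + 2) ^ 3 * real (a n)"
        by (simp add: power3_eq_cube mult_mono algebra_simps)
      also have "\<dots> \<le> real (n + 2) ^ 5 * real (a n)"
        by (intro mult_right_mono power_increasing) simp_all
      finally show ?thesis
        using x5 x0 by (simp add: field_simps)
    qed
    moreover have "real (n + 2) / x \<le> real (n + 2) / real (n + 2) ^ 5"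
    proof -
      have "real (n + 2) ^ 5 * 1 \<le> real (n + 2) ^ 5 * real (a n)"
        using an by (intro mult_left_mono) simp_all
      then have "real (n + 2) ^ 5 \<le> x"
        using x5 by linarith
      then show ?thesis
        by (intro divide_left_mono) (use x0 in simp_all)
    qed
    moreover have "real (n + 2) * real (counting ?B x) / x
        \<le> real (n + 2) * (real ((n + 1) * a n) + x / real (P n) * (1 + 1 / real (n + 1)) + 1) / x"
      using B x0 by (intro divide_right_mono mult_left_mono) simp_all
    moreover have "real (n + 2) * (real ((n + 1) * a n) + x / real (P n) * (1 + 1 / real (n + 1)) + 1) / x
        = real (n + 2) * real ((n + 1) * a n) / x
          + real (n + 2) / real (P n) * (1 + 1 / real (n + 1)) + real (n + 2) / x"
    proof -
      have "k * (y + x / w * z + 1) / x = k * y / x + k / w * z + k / x" for k y w z :: real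
        using x0 by (simp add: distrib_left add_divide_distrib)
      then show ?thesis .
    qed
    ultimately show ?thesis
      unfolding A U_def by simp
  qed
  have "((\<lambda>x. real (counting ?A x) * real (counting ?B x) / x) \<longlongrightarrow> 1) at_top"
  proof (rule tendsto_sandwich)
    show "\<forall>\<^sub>F x in at_top. (x - real (2 * a 1 + 1)) / x
        \<le> real (counting ?A x) * real (counting ?B x) / x"
      using eventually_gt_at_top[of 0]
    proof eventually_elim
      case (elim x)
      then show ?case
        using counting_product_ge[OF pos, of "2 * a 1" x, OF cov] by (intro divide_right_mono) simp_all
    qed
    show "\<forall>\<^sub>F x in at_top. real (counting ?A x) * real (counting ?B x) / x
        \<le> U (counting ?A x - 2)"
      using eventually_ge_at_top[of "real (a 1)"] by (rule eventually_mono) (rule upper)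
    show "((\<lambda>x. (x - real (2 * a 1 + 1)) / x) \<longlongrightarrow> 1) at_top"
      by real_asymp
  qed fact
  then show ?thesis
    unfolding exact_additive_complements_def additive_complements_def
    using pos cov by (auto simp: eventually_at_top_linorder)
qed

section \<open>The excess at infinitely many points\<close>

text \<open>With \<open>N = n + 1\<close>, the main term is
  \<open>(N + 1) * x / N - x - x / (N + 1) = x / (N * (N + 1))\<close>, which normalises to
  \<open>1 + 1 / N\<close>. The stray elements add at most another \<open>1 / N\<close>.\<close>

lemma excess_at_perfect_stage:
  assumes a: "rapidly_growing a" and "1 \<le> n" and "max_modulus a n = n + 1"
  defines "x \<equiv> real (a (Suc n))"
  shows "(real (counting (range a) x) * real (counting (complement_of a) x) - x
      - real (largest_upto (range a) x) / real (counting (range a) x))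
    / (real (largest_upto (range a) x) / (real (counting (range a) x))\<^sup>2)
    \<le> 1 + 2 / real (n + 1)"
proof -
  have less: "x < real (a (Suc (Suc n)))"
    unfolding x_def using rapidly_growing_strict_mono[OF a] by (simp add: strict_mono_less)
  have A: "counting (range a) x = n + 2"
    using counting_range[OF a _ less] by (simp add: x_def)
  have largest: "real (largest_upto (range a) x) = x"
    using largest_upto_range[OF a _ less] by (simp add: x_def)
  have x0: "0 < x"
    unfolding x_def using rapidly_growing_pos[OF a] by simp
  \<comment> \<open>Here \<open>1 \<le> n\<close> puts \<open>x\<close> strictly before the start of
    range \<open>Suc n\<close>.\<close>
  have "x < real (Suc n * a (Suc n))"
    using assms(2) x0 by (simp add: x_def)
  then have B: "real (counting (complement_of a) x) \<le> real ((n + 1) * a n) + x / real (n + 1)"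
    using counting_complement_before[OF a _ _ less] x0 assms(3) by simp
  define N where "N = real (n + 1)"
  define d where "d = real (a n)"
  define b where "b = real (counting (complement_of a) x)"
  have N: "0 < N" "real (n + 2) = N + 1" "real (n + 1) = N"
    by (simp_all add: N_def)
  have b: "b \<le> N * d + x / N"
    using B unfolding b_def N_def d_def by (simp add: algebra_simps)
  have x5: "(N + 1) ^ 5 * d \<le> x"
    unfolding d_def x_def N(2)[symmetric] by (rule growth_bound[OF a])
  \<comment> \<open>The fifth power is spent here: two factors absorb \<open>N * N\<close>, three
    remain for the normalisation.\<close>
  have "N * (N * d) * (N + 1) ^ 3 \<le> (N + 1) * ((N + 1) * d) * (N + 1) ^ 3"
    using N(1) by (intro mult_right_mono mult_mono) (simp_all add: d_def)
  also have "\<dots> = (N + 1) ^ 5 * d"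
    by (simp add: eval_nat_numeral)
  finally have err: "N * d * (N + 1) ^ 3 \<le> x / N"
    using x5 N(1) by (simp add: field_simps)
  have "((N + 1) * b - x - x / (N + 1)) / (x / (N + 1)\<^sup>2)
      = ((N + 1) * b - x - x / (N + 1)) * (N + 1)\<^sup>2 / x"
    by simp
  also have "\<dots> \<le> ((N + 1) * (N * d + x / N) - x - x / (N + 1)) * (N + 1)\<^sup>2 / x"
    using b N(1) x0 by (intro divide_right_mono mult_right_mono diff_right_mono mult_left_mono) simp_all
  also have "\<dots> = (N * d * (N + 1) ^ 3) / x + (N + 1) / N"
    using N(1) x0 by (simp add: divide_simps) (simp add: algebra_simps power2_eq_square power3_eq_cube)
  also have "\<dots> \<le> (x / N) / x + (N + 1) / N"
    using err x0 by (intro add_right_mono divide_right_mono) simp_all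
  also have "\<dots> = 1 + 2 / N"
    using N(1) x0 by (simp add: field_simps)
  finally show ?thesis
    unfolding A largest N b_def .
qed

theorem theorem1p2:
  shows "\<exists>A B :: nat set.
    infinite A \<and> A \<subseteq> {0<..} \<and> B \<subseteq> {0<..} \<and>
    exact_additive_complements A B \<and>
    filterlim (\<lambda>n::nat. real (nth_element A (n + 1)) / (real n * real (nth_element A n)))
      at_top sequentially \<and>
    Liminf sequentially (\<lambda>x::nat. ereal
      ((real (counting A (real x)) * real (counting B (real x)) - real x
          - real (largest_upto A (real x)) / real (counting A (real x)))
        / (real (largest_upto A (real x)) / (real (counting A (real x)))\<^sup>2))) \<le> 1"
proof -
  obtain a where a: "rapidly_growing a"
    and freq: "\<exists>\<^sub>F n in sequentially. max_modulus a n = n + 1"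
    and lim: "(\<lambda>n. real (max_modulus a n) / real (n + 1)) \<longlonglongrightarrow> 1"
    using economical_sequence_exists by blast
  let ?A = "range a" and ?B = "complement_of a"
  note mono = rapidly_growing_strict_mono[OF a]
  have inf: "infinite ?A"
    using mono by (simp add: range_inj_infinite strict_mono_imp_inj_on)
  have exact: "exact_additive_complements ?A ?B"
    using a lim by (rule complement_exact)
  have growth: "filterlim (\<lambda>n::nat. real (nth_element ?A (n + 1))
      / (real n * real (nth_element ?A n))) at_top sequentially"
  proof (rule filterlim_at_top_mono[OF filterlim_real_sequentially])
    show "\<forall>\<^sub>F n in sequentially. real n
        \<le> real (nth_element ?A (n + 1)) / (real n * real (nth_element ?A n))"
      using eventually_gt_at_top[of 0]
    proof eventually_elim
      case (elim n)
      then obtain m where m: "n = Suc m"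
        by (cases n) auto
      have am: "0 < real (a m)"
        using rapidly_growing_pos[OF a, of m] by simp
      \<comment> \<open>Two of the five factors already make the ratio at least
        \<open>n\<close>.\<close>
      have "real n * (real n * real (a m)) \<le> real (m + 2) ^ 2 * real (a m)"
        unfolding m by (simp add: power2_eq_square mult_mono mult.assoc[symmetric])
      also have "\<dots> \<le> real (m + 2) ^ 5 * real (a m)"
        by (intro mult_right_mono power_increasing) simp_all
      also have "\<dots> \<le> real (a n)"
        unfolding m by (rule growth_bound[OF a])
      finally have "real n \<le> real (a n) / (real n * real (a m))"
        using am elim by (simp add: pos_le_divide_eq)
      then show ?case
        using nth_element_range[OF mono, of m] nth_element_range[OF mono, of n] m by simp
    qed
  qed
  define F where "F x = (real (counting ?A (real x)) * real (counting ?B (real x)) - real x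
          - real (largest_upto ?A (real x)) / real (counting ?A (real x)))
        / (real (largest_upto ?A (real x)) / (real (counting ?A (real x)))\<^sup>2)" for x :: nat
  have "Liminf sequentially (\<lambda>x. ereal (F x)) \<le> 1"
  proof (rule ccontr)
    assume "\<not> ?thesis"
    \<comment> \<open>A real \<open>c\<close> strictly between 1 and the lower limit would
      eventually be exceeded by \<open>F\<close>, against the bound \<open>1 + 2 / (n + 1)\<close>
      at infinitely many perfect stages.\<close>
    then obtain c where c: "1 < ereal c" "ereal c < Liminf sequentially (\<lambda>x. ereal (F x))"
      using ereal_dense2[of 1] by (auto simp: not_le)
    then have "\<forall>\<^sub>F x in sequentially. c < F x"
      using less_LiminfD[OF c(2)] by simp
    then obtain X where X: "\<And>x. X \<le> x \<Longrightarrow> c < F x"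
      by (auto simp: eventually_sequentially)
    have "(\<lambda>n. 1 + 2 / real (n + 1)) \<longlonglongrightarrow> 1"
      by real_asymp
    then have "\<forall>\<^sub>F n in sequentially. 1 + 2 / real (n + 1) < c"
      by (rule order_tendstoD) (use c(1) in simp)
    then have "\<forall>\<^sub>F n in sequentially. 1 + 2 / real (n + 1) < c \<and> 1 \<le> n \<and> X \<le> n"
      by (intro eventually_conj eventually_ge_at_top)
    from frequently_eventually_frequently[OF freq this]
    obtain n where n: "max_modulus a n = n + 1" "1 + 2 / real (n + 1) < c" "1 \<le> n" "X \<le> n"
      by (auto dest: frequently_ex)
    \<comment> \<open>This carries \<open>X \<le> n\<close> over to the argument
      \<open>a (Suc n)\<close> of \<open>F\<close>.\<close>
    have "Suc n \<le> a (Suc n)"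
      using strict_mono_imp_increasing[OF mono] .
    then have "c < F (a (Suc n))"
      using X n(4) by simp
    moreover have "F (a (Suc n)) \<le> 1 + 2 / real (n + 1)"
      unfolding F_def by (rule excess_at_perfect_stage[OF a n(3,1)])
    ultimately show False
      using n(2) by linarith
  qed
  then show ?thesis
    using inf exact growth
    unfolding F_def exact_additive_complements_def additive_complements_def by blast
qed

end
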